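(* Let $p\in(0,\tfrac12]$, $r\ge1$, $\delta>0$, and let $f\colon\{0,1\}^n\to\{0,1,-1\}$. Suppose that $\mathrm{I}_S(f^{\le r})\le\delta$ for each set $S\subseteq[n]$ with $|S|\le r$. Then \[\mathbb{E}[(f^{\le r})^2]\le 5^r\delta^{1/3}\,\mathbb{E}[f^2],\] with expectations over $\mu_p$.
   Context: $\mu_p$ is the $p$-biased product measure on $\{0,1\}^n$. $\sigma=\sqrt{p(1-p)}$, $\chi_i(x)=(x_i-p)/\sigma$, $\chi_S=\prod_{i\in S}\chi_i$, $f=\sum_S\hat f(S)\chi_S$ (the $p$-biased Fourier expansion). $f^{\le r}=\sum_{|S|\le r}\hat f(S)\chi_S$. The generalised influence is $\mathrm{I}_S(g)=\sigma^{-2|S|}\sum_{T\supseteq S}\hat g(T)^2$ (equivalently $\mathbb{E}_{\mu_p}[(\sum_{x\in\{0,1\}^S}(-1)^{|S|-|x|}g_{S\to x})^2]$, where $g_{S\to x}$ fixes the coordinates of $S$ to $x$). *)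

theory Defs
  imports "HOL-Probability.Probability"
begin

text \<open>A point of the cube over the coordinates \<open>1, \<dots>, n\<close> is a function \<open>nat \<Rightarrow> bool\<close>
  (\<open>True\<close> is 1) that takes the value \<open>False\<close> outside of \<open>{1..n}\<close>, so that functions on the
  cube are total functions of which only the values on \<open>cube n\<close> matter.\<close>

definition cube :: "nat \<Rightarrow> (nat \<Rightarrow> bool) set" where
  "cube n = PiE_dflt {1..n} False (\<lambda>_. UNIV)"

definition mu :: "real \<Rightarrow> nat \<Rightarrow> (nat \<Rightarrow> bool) pmf" where
  "mu p n = Pi_pmf {1..n} False (\<lambda>_. bernoulli_pmf p)"

abbreviation expect :: "real \<Rightarrow> nat \<Rightarrow> ((nat \<Rightarrow> bool) \<Rightarrow> real) \<Rightarrow> real" where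
  "expect p n g \<equiv> measure_pmf.expectation (mu p n) g"

definition bias_sigma :: "real \<Rightarrow> real" where
  "bias_sigma p = sqrt (p * (1 - p))"

definition chi :: "real \<Rightarrow> nat set \<Rightarrow> (nat \<Rightarrow> bool) \<Rightarrow> real" where
  "chi p S x = (\<Prod>i\<in>S. (of_bool (x i) - p) / bias_sigma p)"

text \<open>The coefficient of \<open>chi p S\<close> in the \<open>p\<close>-biased expansion of \<open>f\<close>; see
  \<open>fourier_expansion\<close> below.\<close>

definition fourier_coeff ::
    "real \<Rightarrow> nat \<Rightarrow> ((nat \<Rightarrow> bool) \<Rightarrow> real) \<Rightarrow> nat set \<Rightarrow> real" where
  "fourier_coeff p n f S = expect p n (\<lambda>x. f x * chi p S x)"

definition low_degree ::
    "real \<Rightarrow> nat \<Rightarrow> nat \<Rightarrow> ((nat \<Rightarrow> bool) \<Rightarrow> real) \<Rightarrow> (nat \<Rightarrow> bool) \<Rightarrow> real" where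
  "low_degree p n r f x =
     (\<Sum>S\<in>{S. S \<subseteq> {1..n} \<and> card S \<le> r}. fourier_coeff p n f S * chi p S x)"

definition gen_influence ::
    "real \<Rightarrow> nat \<Rightarrow> nat set \<Rightarrow> ((nat \<Rightarrow> bool) \<Rightarrow> real) \<Rightarrow> real" where
  "gen_influence p n S g =
     (\<Sum>T\<in>{T. S \<subseteq> T \<and> T \<subseteq> {1..n}}. (fourier_coeff p n g T)\<^sup>2) / bias_sigma p ^ (2 * card S)"

lemma finite_cube: "finite (cube n)"
  unfolding cube_def by (intro finite_PiE_dflt) auto

lemma expect_eq_sum: "expect p n g = (\<Sum>x\<in>cube n. pmf (mu p n) x * g x)"
proof -
  have "set_pmf (mu p n) \<subseteq> cube n"
    unfolding mu_def cube_def by (auto simp: set_Pi_pmf PiE_dflt_def)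
  then show ?thesis
    by (subst integral_measure_pmf[OF finite_cube]) auto
qed

lemma fourier_expansion:
  assumes "0 < p" "p < 1" and x: "x \<in> cube n"
  shows "f x = (\<Sum>S\<in>Pow {1..n}. fourier_coeff p n f S * chi p S x)"
proof -
  define c where "c = (\<lambda>(z::nat \<Rightarrow> bool) i. (of_bool (z i) - p) / bias_sigma p)"
  have s2: "bias_sigma p * bias_sigma p = p * (1 - p)"
    using assms by (simp add: bias_sigma_def)
  have one: "1 + c y i * c x i = (if y i = x i then 1 / pmf (bernoulli_pmf p) (x i) else 0)"
    for y i
  proof -
    have e: "c y i * c x i = (of_bool (y i) - p) * (of_bool (x i) - p) / (p * (1 - p))"
      unfolding c_def by (simp add: s2)
    have "p \<noteq> 0" "1 - p \<noteq> 0" "0 \<le> p" "p \<le> 1"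
      using assms by auto
    then show ?thesis
      unfolding e by (cases "x i"; cases "y i"; simp add: divide_simps; simp add: algebra_simps)
  qed
  have kernel: "(\<Sum>S\<in>Pow {1..n}. chi p S y * chi p S x) = (\<Prod>i\<in>{1..n}. 1 + c y i * c x i)" for y
  proof -
    have "(\<Prod>i\<in>{1..n}. c y i * c x i + 1) =
        (\<Sum>S\<in>Pow {1..n}. (\<Prod>i\<in>S. c y i * c x i) * (\<Prod>i\<in>{1..n}-S. 1))"
      by (rule prod_add) simp
    moreover have "chi p S z = (\<Prod>i\<in>S. c z i)" for S z
      by (simp add: chi_def c_def)
    ultimately show ?thesis
      by (simp add: prod.distrib add.commute)
  qed
  have point: "pmf (mu p n) y * (\<Prod>i\<in>{1..n}. 1 + c y i * c x i) = (if y = x then 1 else 0)"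
    if y: "y \<in> cube n" for y
  proof (cases "y = x")
    case True
    have "pmf (mu p n) x = (\<Prod>i\<in>{1..n}. pmf (bernoulli_pmf p) (x i))"
      using x unfolding mu_def cube_def PiE_dflt_def by (intro pmf_Pi') auto
    moreover have "pmf (bernoulli_pmf p) b \<noteq> 0" for b
      using assms by (cases b) auto
    ultimately show ?thesis
      using True by (simp add: one prod_dividef)
  next
    case False
    then obtain i where "y i \<noteq> x i" by auto
    moreover from this have "i \<in> {1..n}"
      using x y by (auto simp: cube_def PiE_dflt_def)
    ultimately have "(\<Prod>i\<in>{1..n}. 1 + c y i * c x i) = 0"
      by (intro prod_zero bexI[of _ i]) (auto simp: one)
    with False show ?thesis by simp
  qed
  have "(\<Sum>S\<in>Pow {1..n}. fourier_coeff p n f S * chi p S x) =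
      (\<Sum>S\<in>Pow {1..n}. \<Sum>y\<in>cube n. f y * (pmf (mu p n) y * (chi p S y * chi p S x)))"
    unfolding fourier_coeff_def expect_eq_sum sum_distrib_right by (simp only: mult_ac)
  also have "\<dots> = (\<Sum>y\<in>cube n. f y * (pmf (mu p n) y *
      (\<Sum>S\<in>Pow {1..n}. chi p S y * chi p S x)))"
    by (subst sum.swap) (simp add: sum_distrib_left)
  also have "\<dots> = (\<Sum>y\<in>cube n. if y = x then f y else 0)"
    by (intro sum.cong refl) (simp only: kernel point, simp)
  also have "\<dots> = f x"
    using x by (simp add: finite_cube)
  finally show ?thesis by simp
qed

end

theory Submission
  imports Defs
begin

text \<open>Write \<open>g\<close> for the low-degree part of \<open>f\<close>, \<open>W = E[g\<^sup>2]\<close> and \<open>F = E[f\<^sup>2]\<close>. Induction on the number of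
  coordinates gives the bilinear hypercontractive inequality
  \<open>E[g\<^sup>2 h\<^sup>2] \<le> (\<Sum>S. \<sigma>^(-2|S|) N\<^sub>S(g) N\<^sub>S(h))\<close>, where \<open>N\<^sub>S(g)\<close> is the sum of
  \<open>4^|T|\<close> times the squared coefficient of \<open>g\<close> at \<open>T\<close> over all \<open>T \<supseteq> S\<close>. Being bilinear in
  \<open>(g\<^sup>2, h\<^sup>2)\<close>, it survives the induction, which the special case \<open>g = h\<close> would not. For \<open>g = h\<close> of
  degree at most \<open>r\<close>, one factor \<open>N\<^sub>S(g)\<close> is at most \<open>4^r \<sigma>^(2|S|) \<delta>\<close> by the hypothesis on
  the influences, and summing the other one over \<open>S\<close> yields \<open>E[g\<^sup>4] \<le> 32^r \<delta> W\<close>. As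
  \<open>f\<close> takes values in \<open>{0, 1, -1}\<close>, two applications of Cauchy-Schwarz to \<open>W = E[f g]\<close> give
  \<open>W\<^sup>4 \<le> F\<^sup>3 E[g\<^sup>4]\<close>, hence \<open>W\<^sup>3 \<le> 125^r \<delta> F\<^sup>3\<close>.\<close>

section \<open>Biased measures and character expansions over an arbitrary finite set of
  coordinates\<close>

abbreviation bexpect :: "real \<Rightarrow> nat set \<Rightarrow> ((nat \<Rightarrow> bool) \<Rightarrow> real) \<Rightarrow> real" where
  "bexpect p A \<equiv> measure_pmf.expectation (Pi_pmf A False (\<lambda>_. bernoulli_pmf p))"

text \<open>The coefficients are a free argument because the induction on \<open>A\<close> also
  needs the family \<open>a \<circ> insert i\<close>, which describes the part of the function that
  carries coordinate \<open>i\<close>.\<close>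

definition walsh :: "real \<Rightarrow> nat set \<Rightarrow> (nat set \<Rightarrow> real) \<Rightarrow> (nat \<Rightarrow> bool) \<Rightarrow> real" where
  "walsh p A a x = (\<Sum>S\<in>Pow A. a S * chi p S x)"

text \<open>For \<open>w T = (a T)\<^sup>2\<close> this is the generalised influence of
  \<open>walsh p A a\<close> at \<open>S\<close>, multiplied by
  \<open>bias_sigma p ^ (2 * card S)\<close>. The indicator keeps the index set a full power set,
  which \<open>sum_Pow_insert\<close> can split.\<close>

definition upper_sum :: "nat set \<Rightarrow> (nat set \<Rightarrow> real) \<Rightarrow> nat set \<Rightarrow> real" where
  "upper_sum A w S = (\<Sum>T\<in>Pow A. of_bool (S \<subseteq> T) * w T)"

lemma finite_set_Pi_bernoulli:
  assumes "finite A"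
  shows "finite (set_pmf (Pi_pmf A False (\<lambda>_. bernoulli_pmf p)))"
proof (rule finite_subset)
  show "set_pmf (Pi_pmf A False (\<lambda>_. bernoulli_pmf p)) \<subseteq> PiE_dflt A False (\<lambda>_. UNIV)"
    using assms by (auto simp: set_Pi_pmf PiE_dflt_def)
qed (use assms in \<open>auto intro!: finite_PiE_dflt\<close>)

lemma integrable_Pi_bernoulli:
  assumes "finite A"
  shows "integrable (measure_pmf (Pi_pmf A False (\<lambda>_. bernoulli_pmf p))) (F :: _ \<Rightarrow> real)"
  by (intro integrable_measure_pmf_finite finite_set_Pi_bernoulli assms)

lemma bexpect_insert:
  assumes "finite A" "i \<notin> A" "0 < p" "p < 1"
  shows "bexpect p (insert i A) F =
    bexpect p A (\<lambda>x. p * F (x(i := True)) + (1 - p) * F (x(i := False)))"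
proof -
  let ?P = "\<lambda>A. Pi_pmf A False (\<lambda>_. bernoulli_pmf p)"
  note int = integrable_Pi_bernoulli[OF assms(1)]
  have "?P (insert i A) = bernoulli_pmf p \<bind> (\<lambda>b. map_pmf (\<lambda>x. x(i := b)) (?P A))"
    using assms by (simp add: Pi_pmf_insert' map_pmf_def)
  moreover have "measure_pmf.expectation (bernoulli_pmf p \<bind> (\<lambda>b. map_pmf (\<lambda>x. x(i := b)) (?P A))) F
      = (\<Sum>b\<in>UNIV. pmf (bernoulli_pmf p) b *\<^sub>R
           measure_pmf.expectation (map_pmf (\<lambda>x. x(i := b)) (?P A)) F)"
    by (rule pmf_expectation_bind) (use assms finite_set_Pi_bernoulli in auto)
  ultimately show ?thesis
    using assms int by (simp add: UNIV_bool)
qed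

lemma sum_Pow_insert:
  assumes "i \<notin> A" "finite A"
  shows "sum F (Pow (insert i A)) = sum F (Pow A) + (\<Sum>S\<in>Pow A. F (insert i S))"
proof -
  have "inj_on (insert i) (Pow A)"
    using assms by (auto simp: inj_on_def)
  moreover have "sum F (Pow (insert i A)) = sum F (Pow A) + sum F (insert i ` Pow A)"
    unfolding Pow_insert by (rule sum.union_disjoint) (use assms in auto)
  ultimately show ?thesis
    by (simp add: sum.reindex)
qed

lemma chi_insert_upd:
  assumes "i \<notin> A" "finite A" "S \<subseteq> A"
  shows "chi p S (x(i := b)) = chi p S x"
    and "chi p (insert i S) (x(i := b)) = (of_bool b - p) / bias_sigma p * chi p S x"
proof -
  have S: "finite S" "i \<notin> S" using assms by (auto intro: finite_subset)
  show *: "chi p S (x(i := b)) = chi p S x"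
    unfolding chi_def by (rule prod.cong) (use S in auto)
  show "chi p (insert i S) (x(i := b)) = (of_bool b - p) / bias_sigma p * chi p S x"
    using S * by (simp add: chi_def)
qed

text \<open>Separates the sets without \<open>i\<close> from those with it; each of the latter
  contributes the normalised coordinate as a factor. The two remaining expansions do not depend on
  coordinate \<open>i\<close>.\<close>

lemma walsh_insert:
  assumes "i \<notin> A" "finite A"
  shows "walsh p (insert i A) a (x(i := b)) =
    walsh p A a x + (of_bool b - p) / bias_sigma p * walsh p A (a \<circ> insert i) x"
proof -
  have "(\<Sum>S\<in>Pow A. a S * chi p S (x(i := b))) = (\<Sum>S\<in>Pow A. a S * chi p S x)"
    by (rule sum.cong) (use assms chi_insert_upd in auto)
  moreover have "(\<Sum>S\<in>Pow A. a (insert i S) * chi p (insert i S) (x(i := b))) =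
      (\<Sum>S\<in>Pow A. (of_bool b - p) / bias_sigma p * (a (insert i S) * chi p S x))"
    by (rule sum.cong) (use assms chi_insert_upd in auto)
  ultimately show ?thesis
    unfolding walsh_def sum_Pow_insert[OF assms] by (simp add: sum_distrib_left)
qed

text \<open>Parseval's identity: a normalised coordinate has mean 0 and variance 1, so averaging
  over it removes the cross terms. The form with two functions also serves to read off single
  coefficients.\<close>

lemma bexpect_walsh_mult:
  assumes "finite A" and p: "0 < p" "p < 1"
  shows "bexpect p A (\<lambda>x. walsh p A a x * walsh p A b x) = (\<Sum>S\<in>Pow A. a S * b S)"
  using assms(1)
proof (induction A arbitrary: a b)
  case empty
  then show ?case by (simp add: walsh_def chi_def)
next
  case (insert i A)
  note int = integrable_Pi_bernoulli[OF insert(1)]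
  have s: "bias_sigma p \<noteq> 0" "bias_sigma p ^ 2 = p * (1 - p)"
    using p by (auto simp: bias_sigma_def)
  have step: "p * ((u + (1 - p) / bias_sigma p * u') * (v + (1 - p) / bias_sigma p * v')) +
      (1 - p) * ((u + (0 - p) / bias_sigma p * u') * (v + (0 - p) / bias_sigma p * v')) =
      u * v + u' * v'" for u u' v v' :: real
  proof -
    have "p * ((u + (1 - p) / bias_sigma p * u') * (v + (1 - p) / bias_sigma p * v')) +
      (1 - p) * ((u + (0 - p) / bias_sigma p * u') * (v + (0 - p) / bias_sigma p * v')) =
      u * v + p * (1 - p) / bias_sigma p ^ 2 * (u' * v')"
      using s(1) by (simp add: divide_simps power2_eq_square) (simp add: algebra_simps)
    also have "p * (1 - p) / bias_sigma p ^ 2 = 1" using p s(2) by simp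
    finally show ?thesis by simp
  qed
  let ?a = "a \<circ> insert i" and ?b = "b \<circ> insert i"
  have "bexpect p (insert i A) (\<lambda>x. walsh p (insert i A) a x * walsh p (insert i A) b x) =
      bexpect p A (\<lambda>x. walsh p A a x * walsh p A b x + walsh p A ?a x * walsh p A ?b x)"
    unfolding bexpect_insert[OF insert(1,2) p] walsh_insert[OF insert(2,1)] of_bool_eq step ..
  also have "\<dots> = (\<Sum>S\<in>Pow A. a S * b S) + (\<Sum>S\<in>Pow A. ?a S * ?b S)"
    by (simp only: Bochner_Integration.integral_add[OF int int] insert.IH)
  also have "\<dots> = (\<Sum>S\<in>Pow (insert i A). a S * b S)"
    by (simp add: sum_Pow_insert[OF insert(2,1)])
  finally show ?case .
qed

section \<open>Hypercontractivity: the one-coordinate inequality and its tensorisation\<close>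

lemma upper_sum_insert:
  assumes "i \<notin> A" "finite A" "S \<subseteq> A"
  shows "upper_sum (insert i A) w S = upper_sum A w S + upper_sum A (w \<circ> insert i) S"
    and "upper_sum (insert i A) w (insert i S) = upper_sum A (w \<circ> insert i) S"
proof -
  have "S \<subseteq> insert i T \<longleftrightarrow> S \<subseteq> T" for T using assms by auto
  then show "upper_sum (insert i A) w S = upper_sum A w S + upper_sum A (w \<circ> insert i) S"
    unfolding upper_sum_def sum_Pow_insert[OF assms(1,2)] by simp
  have 1: "(\<Sum>T\<in>Pow A. of_bool (insert i S \<subseteq> T) * w T) = 0"
    by (rule sum.neutral) (use assms in auto)
  have "(\<Sum>T\<in>Pow A. of_bool (insert i S \<subseteq> insert i T) * w (insert i T)) =
      (\<Sum>T\<in>Pow A. of_bool (S \<subseteq> T) * (w \<circ> insert i) T)"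
    by (rule sum.cong) (use assms in auto)
  with 1 show "upper_sum (insert i A) w (insert i S) = upper_sum A (w \<circ> insert i) S"
    unfolding upper_sum_def sum_Pow_insert[OF assms(1,2)] by simp
qed

lemma upper_sum_nonneg: "(\<And>T. w T \<ge> 0) \<Longrightarrow> upper_sum A w S \<ge> 0"
  unfolding upper_sum_def by (intro sum_nonneg) auto

text \<open>Expand in the moments of the normalised coordinate. The coefficient 4 collects 1 from
  the second moment, 2 from the product \<open>4 * u * u' * v * v'\<close> and 1 from the third
  moment; \<open>3 / s\<^sup>2\<close> bounds twice the squared third moment plus the fourth. The
  term \<open>u\<^sup>2 * v\<^sup>2\<close> keeps coefficient 1, so nothing is lost on functions
  that ignore the coordinate.\<close>

lemma two_point_inequality:
  fixes u u' v v' s :: real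
  assumes p: "0 < p" "p < 1" and s: "s\<^sup>2 = p * (1 - p)"
  shows "p * ((u + (1 - p) / s * u')\<^sup>2 * (v + (1 - p) / s * v')\<^sup>2) +
      (1 - p) * ((u + (- p) / s * u')\<^sup>2 * (v + (- p) / s * v')\<^sup>2) \<le>
      u\<^sup>2 * v\<^sup>2 + 4 * (u\<^sup>2 * v'\<^sup>2) + 4 * (u'\<^sup>2 * v\<^sup>2) + 3 / s\<^sup>2 * (u'\<^sup>2 * v'\<^sup>2)"
proof -
  have s0: "s \<noteq> 0" using p s by auto
  \<comment> \<open>These are the third and fourth moments of the normalised coordinate; the first
    two are 0 and 1.\<close>
  define k where "k = (1 - 2 * p) / s"
  define m where "m = (1 - 3 * (p * (1 - p))) / s\<^sup>2"
  have m1: "p * ((1 - p) / s) + (1 - p) * (- p / s) = 0"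
    using s0 by (simp add: field_simps)
  have m2: "p * ((1 - p) / s)\<^sup>2 + (1 - p) * (- p / s)\<^sup>2 = 1"
  proof -
    have "p * ((1 - p) / s)\<^sup>2 + (1 - p) * (- p / s)\<^sup>2 = p * (1 - p) / s\<^sup>2"
      by (simp add: power_divide add_divide_distrib[symmetric]) (simp add: power2_eq_square algebra_simps)
    then show ?thesis using s p by simp
  qed
  have m3: "p * ((1 - p) / s) ^ 3 + (1 - p) * (- p / s) ^ 3 = k"
  proof -
    have "p * ((1 - p) / s) ^ 3 + (1 - p) * (- p / s) ^ 3 = p * (1 - p) * (1 - 2 * p) / s ^ 3"
      by (simp add: power_divide diff_divide_distrib[symmetric]) (simp add: eval_nat_numeral algebra_simps)
    also have "\<dots> = s\<^sup>2 * (1 - 2 * p) / s ^ 3" using s by simp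
    also have "\<dots> = k" using s0 unfolding k_def by (simp add: eval_nat_numeral)
    finally show ?thesis .
  qed
  have m4: "p * ((1 - p) / s) ^ 4 + (1 - p) * (- p / s) ^ 4 = m"
  proof -
    have "p * ((1 - p) / s) ^ 4 + (1 - p) * (- p / s) ^ 4 = p * (1 - p) * (1 - 3 * (p * (1 - p))) / s ^ 4"
      by (simp add: power_divide add_divide_distrib[symmetric]) (simp add: eval_nat_numeral algebra_simps)
    also have "\<dots> = s\<^sup>2 * (1 - 3 * (p * (1 - p))) / s ^ 4" using s by simp
    also have "\<dots> = m" using s0 unfolding m_def by (simp add: eval_nat_numeral)
    finally show ?thesis .
  qed
  have k2: "k\<^sup>2 \<le> 1 / s\<^sup>2" and m': "m \<le> 1 / s\<^sup>2"
  proof -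
    have "(1 - 2 * p)\<^sup>2 \<le> 1" using p by (simp add: abs_square_le_1)
    then show "k\<^sup>2 \<le> 1 / s\<^sup>2" unfolding k_def power_divide by (simp add: divide_right_mono)
    show "m \<le> 1 / s\<^sup>2" unfolding m_def using p by (intro divide_right_mono) auto
  qed
  define c where "c = (1 - p) / s"
  define d where "d = - p / s"
  have "p * ((u + c * u')\<^sup>2 * (v + c * v')\<^sup>2) + (1 - p) * ((u + d * u')\<^sup>2 * (v + d * v')\<^sup>2) =
      u\<^sup>2 * v\<^sup>2 + (p * c + (1 - p) * d) * (2 * u\<^sup>2 * v * v' + 2 * v\<^sup>2 * u * u') +
      (p * c\<^sup>2 + (1 - p) * d\<^sup>2) * (u\<^sup>2 * v'\<^sup>2 + u'\<^sup>2 * v\<^sup>2 + 4 * u * u' * v * v') +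
      (p * c ^ 3 + (1 - p) * d ^ 3) * (2 * (u * v') * (u' * v') + 2 * (v * u') * (u' * v')) +
      (p * c ^ 4 + (1 - p) * d ^ 4) * (u'\<^sup>2 * v'\<^sup>2)"
    by algebra
  also have "\<dots> = u\<^sup>2 * v\<^sup>2 + (u\<^sup>2 * v'\<^sup>2 + u'\<^sup>2 * v\<^sup>2 + 4 * u * u' * v * v') +
      k * (2 * (u * v') * (u' * v') + 2 * (v * u') * (u' * v')) + m * (u'\<^sup>2 * v'\<^sup>2)"
    unfolding c_def d_def m1 m2 m3 m4 by simp
  also have "\<dots> \<le> u\<^sup>2 * v\<^sup>2 + (u\<^sup>2 * v'\<^sup>2 + u'\<^sup>2 * v\<^sup>2 + 2 * (u\<^sup>2 * v'\<^sup>2 + u'\<^sup>2 * v\<^sup>2)) +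
      (u\<^sup>2 * v'\<^sup>2 + u'\<^sup>2 * v\<^sup>2 + 2 * (k\<^sup>2 * (u'\<^sup>2 * v'\<^sup>2))) + m * (u'\<^sup>2 * v'\<^sup>2)"
  proof -
    \<comment> \<open>The first square bounds \<open>4 * u * u' * v * v'\<close>, the other two
      bound the terms with the factor \<open>k\<close>.\<close>
    have "0 \<le> 2 * (u * v' - u' * v)\<^sup>2" "0 \<le> (u * v' - k * (u' * v'))\<^sup>2" "0 \<le> (v * u' - k * (u' * v'))\<^sup>2"
      by auto
    then show ?thesis
      by (simp add: power2_diff power_mult_distrib algebra_simps)
  qed
  also have "\<dots> \<le> u\<^sup>2 * v\<^sup>2 + (u\<^sup>2 * v'\<^sup>2 + u'\<^sup>2 * v\<^sup>2 + 2 * (u\<^sup>2 * v'\<^sup>2 + u'\<^sup>2 * v\<^sup>2)) +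
      (u\<^sup>2 * v'\<^sup>2 + u'\<^sup>2 * v\<^sup>2 + 2 * (1 / s\<^sup>2 * (u'\<^sup>2 * v'\<^sup>2))) + 1 / s\<^sup>2 * (u'\<^sup>2 * v'\<^sup>2)"
    by (intro add_mono mult_left_mono mult_right_mono k2 m' order_refl) auto
  finally show ?thesis unfolding c_def d_def by (simp add: algebra_simps)
qed

text \<open>The factor 4 per element absorbs the coefficient 4 of the mixed terms in
  \<open>two_point_inequality\<close>.\<close>

definition weight :: "(nat set \<Rightarrow> real) \<Rightarrow> nat set \<Rightarrow> real" where
  "weight a T = 4 ^ card T * (a T)\<^sup>2"

lemma upper_sum_weight_insert:
  assumes "i \<notin> A" "finite A"
  shows "upper_sum A (weight a \<circ> insert i) S = 4 * upper_sum A (weight (a \<circ> insert i)) S"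
proof -
  have "weight a (insert i T) = 4 * weight (a \<circ> insert i) T" if "T \<subseteq> A" for T
  proof -
    have "finite T" "i \<notin> T" using that assms by (auto intro: finite_subset)
    then show ?thesis by (simp add: weight_def)
  qed
  then show ?thesis
    unfolding upper_sum_def sum_distrib_left by (intro sum.cong) auto
qed

text \<open>The two-point inequality is averaged over the other coordinates, and the induction
  hypothesis is applied to all four pairs of \<open>a\<close> or \<open>a \<circ> insert i\<close>
  with \<open>b\<close> or \<open>b \<circ> insert i\<close>.\<close>

lemma bilinear_hypercontractivity:
  assumes "finite A" and p: "0 < p" "p < 1"
  shows "bexpect p A (\<lambda>x. (walsh p A a x)\<^sup>2 * (walsh p A b x)\<^sup>2) \<le>
    (\<Sum>S\<in>Pow A. (1 / (bias_sigma p)\<^sup>2) ^ card S *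
       (upper_sum A (weight a) S * upper_sum A (weight b) S))"
  using assms(1)
proof (induction A arbitrary: a b)
  case empty
  then show ?case by (simp add: walsh_def chi_def upper_sum_def weight_def)
next
  case (insert i A)
  note int = integrable_Pi_bernoulli[OF insert(1)]
  define s where "s = bias_sigma p"
  have s2: "s\<^sup>2 = p * (1 - p)"
    using p by (auto simp: bias_sigma_def s_def)
  let ?E = "\<lambda>a b. bexpect p A (\<lambda>x. (walsh p A a x)\<^sup>2 * (walsh p A b x)\<^sup>2)"
  let ?N = "\<lambda>a S. upper_sum A (weight a) S"
  let ?B = "\<lambda>a b. \<Sum>S\<in>Pow A. (1 / s\<^sup>2) ^ card S * (?N a S * ?N b S)"
  let ?a = "a \<circ> insert i" and ?b = "b \<circ> insert i"
  have IH: "?E a b \<le> ?B a b" for a b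
    using insert.IH[of a b] by (simp add: s_def)
  have B0: "?B ?a ?b \<ge> 0"
    by (intro sum_nonneg mult_nonneg_nonneg upper_sum_nonneg) (auto simp: weight_def)
  let ?G = "\<lambda>x. (walsh p A a x)\<^sup>2 * (walsh p A b x)\<^sup>2 + 4 * ((walsh p A a x)\<^sup>2 * (walsh p A ?b x)\<^sup>2) +
      4 * ((walsh p A ?a x)\<^sup>2 * (walsh p A b x)\<^sup>2) + 3 / s\<^sup>2 * ((walsh p A ?a x)\<^sup>2 * (walsh p A ?b x)\<^sup>2)"
  have "bexpect p (insert i A) (\<lambda>x. (walsh p (insert i A) a x)\<^sup>2 * (walsh p (insert i A) b x)\<^sup>2) \<le>
      bexpect p A ?G"
    unfolding bexpect_insert[OF insert(1,2) p]
  proof (rule integral_mono[OF int int])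
    fix x
    show "p * ((walsh p (insert i A) a (x(i := True)))\<^sup>2 * (walsh p (insert i A) b (x(i := True)))\<^sup>2) +
        (1 - p) * ((walsh p (insert i A) a (x(i := False)))\<^sup>2 * (walsh p (insert i A) b (x(i := False)))\<^sup>2)
        \<le> ?G x"
      unfolding walsh_insert[OF insert(2,1)] s_def[symmetric]
      using two_point_inequality[OF p s2, of "walsh p A a x" "walsh p A ?a x" "walsh p A b x" "walsh p A ?b x"]
      by simp
  qed
  also have "\<dots> = ?E a b + 4 * ?E a ?b + 4 * ?E ?a b + 3 / s\<^sup>2 * ?E ?a ?b"
    by (simp add: int)
  also have "\<dots> \<le> ?B a b + 4 * ?B a ?b + 4 * ?B ?a b + 3 / s\<^sup>2 * ?B ?a ?b"
    by (intro add_mono mult_left_mono IH) auto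
  \<comment> \<open>The bound is weakened to match the recursion of the upper sums: a set
    \<open>S\<close> without \<open>i\<close> yields
    \<open>(?N a S + 4 * ?N ?a S) * (?N b S + 4 * ?N ?b S)\<close>, while \<open>insert i S\<close>
    yields \<open>16 * ?N ?a S * ?N ?b S\<close> with one more factor
    \<open>1 / s\<^sup>2\<close>.\<close>
  also have "\<dots> \<le> ?B a b + 4 * ?B a ?b + 4 * ?B ?a b + 16 * ?B ?a ?b + 16 / s\<^sup>2 * ?B ?a ?b"
  proof -
    have "3 / s\<^sup>2 * ?B ?a ?b \<le> 16 / s\<^sup>2 * ?B ?a ?b"
      using B0 by (intro mult_right_mono divide_right_mono) auto
    then show ?thesis using B0 by linarith
  qed
  also have "\<dots> = (\<Sum>S\<in>Pow (insert i A). (1 / s\<^sup>2) ^ card S *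
       (upper_sum (insert i A) (weight a) S * upper_sum (insert i A) (weight b) S))"
  proof -
    have 1: "(\<Sum>S\<in>Pow A. (1 / s\<^sup>2) ^ card S *
       (upper_sum (insert i A) (weight a) S * upper_sum (insert i A) (weight b) S)) =
       ?B a b + 4 * ?B a ?b + 4 * ?B ?a b + 16 * ?B ?a ?b"
      unfolding sum_distrib_left sum.distrib[symmetric]
    proof (rule sum.cong[OF refl])
      fix S assume "S \<in> Pow A"
      then have "S \<subseteq> A" by simp
      then show "(1 / s\<^sup>2) ^ card S *
          (upper_sum (insert i A) (weight a) S * upper_sum (insert i A) (weight b) S) =
          (1 / s\<^sup>2) ^ card S * (?N a S * ?N b S) + 4 * ((1 / s\<^sup>2) ^ card S * (?N a S * ?N ?b S)) +
          4 * ((1 / s\<^sup>2) ^ card S * (?N ?a S * ?N b S)) + 16 * ((1 / s\<^sup>2) ^ card S * (?N ?a S * ?N ?b S))"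
        using insert.hyps
        by (simp add: upper_sum_insert(1) upper_sum_weight_insert distrib_left distrib_right)
    qed
    have 2: "(\<Sum>S\<in>Pow A. (1 / s\<^sup>2) ^ card (insert i S) *
       (upper_sum (insert i A) (weight a) (insert i S) * upper_sum (insert i A) (weight b) (insert i S))) =
       16 / s\<^sup>2 * ?B ?a ?b"
      unfolding sum_distrib_left
    proof (rule sum.cong[OF refl])
      fix S assume "S \<in> Pow A"
      then have S: "S \<subseteq> A" by simp
      then have "finite S" "i \<notin> S" using insert.hyps by (auto intro: finite_subset)
      then show "(1 / s\<^sup>2) ^ card (insert i S) *
          (upper_sum (insert i A) (weight a) (insert i S) * upper_sum (insert i A) (weight b) (insert i S)) =
          16 / s\<^sup>2 * ((1 / s\<^sup>2) ^ card S * (?N ?a S * ?N ?b S))"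
        using insert.hyps S by (simp add: upper_sum_insert upper_sum_weight_insert)
    qed
    show ?thesis
      unfolding sum_Pow_insert[OF insert(2,1)] 1 2 by simp
  qed
  finally show ?case by (simp add: s_def)
qed

section \<open>The fourth moment of a function of low degree and small influences\<close>

lemma sum_upper_sum:
  assumes "finite A"
  shows "(\<Sum>S\<in>Pow A. upper_sum A w S) = (\<Sum>T\<in>Pow A. 2 ^ card T * w T)"
proof -
  \<comment> \<open>Double counting: \<open>T\<close> contributes once for each of its
    subsets.\<close>
  have "(\<Sum>S\<in>Pow A. upper_sum A w S) = (\<Sum>T\<in>Pow A. \<Sum>S\<in>Pow A. of_bool (S \<subseteq> T) * w T)"
    unfolding upper_sum_def by (rule sum.swap)
  also have "\<dots> = (\<Sum>T\<in>Pow A. 2 ^ card T * w T)"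
  proof (rule sum.cong[OF refl])
    fix T assume "T \<in> Pow A"
    then have T: "{S \<in> Pow A. S \<subseteq> T} = Pow T" "finite T"
      using assms by (auto intro: finite_subset)
    have "(\<Sum>S\<in>Pow A. of_bool (S \<subseteq> T) * w T) = (\<Sum>S\<in>{S \<in> Pow A. S \<subseteq> T}. w T)"
      by (rule sum.mono_neutral_cong_right) (use assms in auto)
    also have "\<dots> = 2 ^ card T * w T"
      unfolding T(1) using T(2) by (simp add: card_Pow)
    finally show "(\<Sum>S\<in>Pow A. of_bool (S \<subseteq> T) * w T) = 2 ^ card T * w T" .
  qed
  finally show ?thesis .
qed

text \<open>The base is \<open>32 = 4 * 4 * 2\<close>: removing the weights costs
  \<open>4 ^ r\<close> in each of the two upper sums, and the upper sum that survives counts every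
  \<open>T\<close> with \<open>a T \<noteq> 0\<close> at most \<open>2 ^ r\<close> times.\<close>

lemma walsh_fourth_moment:
  assumes "finite A" and p: "0 < p" "p < 1"
    and deg: "\<And>T. r < card T \<Longrightarrow> a T = 0"
    and inf: "\<And>S. S \<subseteq> A \<Longrightarrow> card S \<le> r \<Longrightarrow>
      upper_sum A (\<lambda>T. (a T)\<^sup>2) S / bias_sigma p ^ (2 * card S) \<le> \<delta>"
    and "\<delta> \<ge> 0"
  shows "bexpect p A (\<lambda>x. walsh p A a x ^ 4) \<le> 32 ^ r * \<delta> * (\<Sum>S\<in>Pow A. (a S)\<^sup>2)"
proof -
  let ?U = "upper_sum A (\<lambda>T. (a T)\<^sup>2)"
  have "a T = 0 \<or> card T \<le> r" for T using deg not_le by blast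
  then have wt: "weight a T \<le> 4 ^ r * (a T)\<^sup>2" for T
    unfolding weight_def by (cases "a T = 0") (auto intro!: mult_right_mono power_increasing)
  have N0: "0 \<le> upper_sum A (weight a) S" for S
    by (rule upper_sum_nonneg) (simp add: weight_def)
  have U0: "0 \<le> ?U S" for S by (rule upper_sum_nonneg) simp
  have N: "upper_sum A (weight a) S \<le> 4 ^ r * ?U S" for S
    unfolding upper_sum_def sum_distrib_left
  proof (rule sum_mono)
    show "of_bool (S \<subseteq> T) * weight a T \<le> 4 ^ r * (of_bool (S \<subseteq> T) * (a T)\<^sup>2)" for T
      using wt[of T] by auto
  qed
  have U: "(1 / (bias_sigma p)\<^sup>2) ^ card S * ?U S \<le> \<delta>" if "S \<subseteq> A" for S
  proof (cases "card S \<le> r")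
    case True
    then show ?thesis using inf[OF that] by (simp add: power_mult power_divide)
  next
    case False
    \<comment> \<open>A set with more than \<open>r\<close> elements, about which \<open>inf\<close>
      says nothing, lies in no set with a nonzero coefficient.\<close>
    have "of_bool (S \<subseteq> T) * (a T)\<^sup>2 = 0" if "T \<in> Pow A" for T
    proof (cases "S \<subseteq> T")
      case True
      have "finite T" using that assms(1) by (auto intro: finite_subset)
      then have "r < card T" using False card_mono[OF _ True] by linarith
      then show ?thesis by (simp add: deg)
    qed simp
    then have "?U S = 0" unfolding upper_sum_def by (simp only: sum.neutral_const cong: sum.cong)
    then show ?thesis using \<open>\<delta> \<ge> 0\<close> by simp
  qed
  have "bexpect p A (\<lambda>x. walsh p A a x ^ 4) =
      bexpect p A (\<lambda>x. (walsh p A a x)\<^sup>2 * (walsh p A a x)\<^sup>2)"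
    by (simp add: power2_eq_square eval_nat_numeral mult.assoc)
  also have "\<dots> \<le> (\<Sum>S\<in>Pow A. (1 / (bias_sigma p)\<^sup>2) ^ card S *
       (upper_sum A (weight a) S * upper_sum A (weight a) S))"
    by (rule bilinear_hypercontractivity[OF assms(1) p])
  also have "\<dots> \<le> (\<Sum>S\<in>Pow A. (1 / (bias_sigma p)\<^sup>2) ^ card S * ((4 ^ r * ?U S) * (4 ^ r * ?U S)))"
    by (intro sum_mono mult_left_mono mult_mono N N0) (auto simp: U0)
  also have "\<dots> = (\<Sum>S\<in>Pow A. 16 ^ r * (((1 / (bias_sigma p)\<^sup>2) ^ card S * ?U S) * ?U S))"
  proof -
    have "(16::real) ^ r = 4 ^ r * 4 ^ r" by (simp add: power_mult_distrib[symmetric])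
    then show ?thesis by (simp add: mult_ac)
  qed
  \<comment> \<open>Only one of the two equal factors is exchanged for \<open>\<delta>\<close>; the
    other is kept to produce the sum of squares.\<close>
  also have "\<dots> \<le> (\<Sum>S\<in>Pow A. 16 ^ r * (\<delta> * ?U S))"
    by (intro sum_mono mult_left_mono mult_right_mono U U0) auto
  also have "\<dots> = 16 ^ r * \<delta> * (\<Sum>T\<in>Pow A. 2 ^ card T * (a T)\<^sup>2)"
    unfolding sum_upper_sum[OF assms(1), symmetric] sum_distrib_left by (simp add: mult_ac)
  also have "\<dots> \<le> 16 ^ r * \<delta> * (\<Sum>T\<in>Pow A. 2 ^ r * (a T)\<^sup>2)"
  proof (intro mult_left_mono sum_mono)
    show "2 ^ card T * (a T)\<^sup>2 \<le> 2 ^ r * (a T)\<^sup>2" for T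
      using deg[of T] by (cases "card T \<le> r") (auto intro!: mult_right_mono power_increasing)
  qed (use \<open>\<delta> \<ge> 0\<close> in auto)
  also have "\<dots> = 32 ^ r * \<delta> * (\<Sum>S\<in>Pow A. (a S)\<^sup>2)"
  proof -
    have "(32::real) ^ r = 16 ^ r * 2 ^ r" by (simp add: power_mult_distrib[symmetric])
    then show ?thesis by (simp add: sum_distrib_left[symmetric] mult_ac)
  qed
  finally show ?thesis .
qed

section \<open>Cauchy-Schwarz and Fourier coefficients on the cube\<close>

lemma expect_Cauchy_Schwarz:
  "(expect p n (\<lambda>x. F x * G x))\<^sup>2 \<le> expect p n (\<lambda>x. (F x)\<^sup>2) * expect p n (\<lambda>x. (G x)\<^sup>2)"
proof -
  \<comment> \<open>Sharing the probability evenly between both functions reduces the claim to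
    Cauchy-Schwarz for finite sums.\<close>
  define q where "q x = sqrt (pmf (mu p n) x)" for x
  have q: "pmf (mu p n) x = (q x)\<^sup>2" for x by (simp add: q_def)
  show ?thesis
    using Cauchy_Schwarz_ineq_sum[of "\<lambda>x. q x * F x" "\<lambda>x. q x * G x" "cube n"]
    unfolding expect_eq_sum q by (simp add: power2_eq_square mult_ac)
qed

text \<open>Moves the truncation from the index set into the coefficients, so that the results on
  \<open>walsh\<close> apply.\<close>

lemma low_degree_eq_walsh:
  "low_degree p n r f =
    walsh p {1..n} (\<lambda>S. if card S \<le> r then fourier_coeff p n f S else 0)"
proof
  fix x
  show "low_degree p n r f x =
      walsh p {1..n} (\<lambda>S. if card S \<le> r then fourier_coeff p n f S else 0) x"
    unfolding low_degree_def walsh_def by (rule sum.mono_neutral_cong_left) auto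
qed

text \<open>Uniqueness of the expansion: \<open>chi p T\<close> is itself a \<open>walsh\<close>
  with an indicator as coefficients, and Parseval's identity picks out \<open>a T\<close>.\<close>

lemma fourier_coeff_walsh:
  assumes "0 < p" "p < 1" "T \<subseteq> {1..n}"
  shows "fourier_coeff p n (walsh p {1..n} a) T = a T"
proof -
  have "walsh p {1..n} (\<lambda>S. of_bool (S = T)) = chi p T"
  proof
    fix x
    have "walsh p {1..n} (\<lambda>S. of_bool (S = T)) x = (\<Sum>S\<in>{T}. chi p S x)"
      unfolding walsh_def by (rule sum.mono_neutral_cong_right) (use assms(3) in auto)
    then show "walsh p {1..n} (\<lambda>S. of_bool (S = T)) x = chi p T x" by simp
  qed
  moreover have "(\<Sum>S\<in>Pow {1..n}. a S * of_bool (S = T)) = (\<Sum>S\<in>{T}. a S)"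
    by (rule sum.mono_neutral_cong_right) (use assms(3) in auto)
  ultimately show ?thesis
    using bexpect_walsh_mult[of "{1..n}" p a "\<lambda>S. of_bool (S = T)"] assms
    by (simp add: fourier_coeff_def mu_def)
qed

text \<open>Linearity alone gives this; \<open>f\<close> itself is not expanded.\<close>

lemma expect_mult_walsh:
  "expect p n (\<lambda>x. f x * walsh p {1..n} a x) = (\<Sum>S\<in>Pow {1..n}. fourier_coeff p n f S * a S)"
  unfolding walsh_def fourier_coeff_def expect_eq_sum sum_distrib_left sum_distrib_right
  by (subst sum.swap) (simp add: mult_ac)

section \<open>From the fourth moment to the level inequality\<close>

theorem theorem5p4:
  fixes p \<delta> :: real and n r :: nat and f :: "(nat \<Rightarrow> bool) \<Rightarrow> real"
  assumes "0 < p" and "p \<le> 1 / 2"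
    and "r \<ge> 1"
    and "\<delta> > 0"
    and "\<And>x. x \<in> cube n \<Longrightarrow> f x \<in> {0, 1, -1}"
    and "\<And>S. S \<subseteq> {1..n} \<Longrightarrow> card S \<le> r \<Longrightarrow> gen_influence p n S (low_degree p n r f) \<le> \<delta>"
  shows "expect p n (\<lambda>x. (low_degree p n r f x)\<^sup>2)
           \<le> 5 ^ r * \<delta> powr (1 / 3) * expect p n (\<lambda>x. (f x)\<^sup>2)"
proof -
  have p: "0 < p" "p < 1" using assms by auto
  define a where "a S = (if card S \<le> r then fourier_coeff p n f S else 0)" for S
  define g where "g = walsh p {1..n} a"
  have g: "low_degree p n r f = g"
    unfolding g_def a_def by (rule low_degree_eq_walsh)
  define W where "W = (\<Sum>S\<in>Pow {1..n}. (a S)\<^sup>2)"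
  define F where "F = expect p n (\<lambda>x. (f x)\<^sup>2)"
  have W0: "W \<ge> 0" unfolding W_def by (rule sum_nonneg) simp
  have F0: "F \<ge> 0" unfolding F_def by simp
  have Wg: "expect p n (\<lambda>x. (g x)\<^sup>2) = W"
    using bexpect_walsh_mult[of "{1..n}" p a a] p
    by (simp add: g_def W_def mu_def power2_eq_square)
  \<comment> \<open>The coefficients of \<open>f\<close> and \<open>g\<close> agree wherever
    \<open>a\<close> is nonzero.\<close>
  have Wf: "expect p n (\<lambda>x. f x * g x) = W"
    unfolding g_def expect_mult_walsh W_def by (rule sum.cong) (auto simp: a_def power2_eq_square)
  have g4: "expect p n (\<lambda>x. g x ^ 4) \<le> 32 ^ r * \<delta> * W"
    unfolding W_def g_def mu_def
  proof (rule walsh_fourth_moment)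
    fix S assume S: "S \<subseteq> {1..n}" "card S \<le> r"
    have "(\<Sum>T\<in>{T. S \<subseteq> T \<and> T \<subseteq> {1..n}}. (fourier_coeff p n g T)\<^sup>2) = upper_sum {1..n} (\<lambda>T. (a T)\<^sup>2) S"
      unfolding upper_sum_def
      by (rule sum.mono_neutral_cong_left) (auto simp: g_def fourier_coeff_walsh p simp del: One_nat_def)
    then show "upper_sum {1..n} (\<lambda>T. (a T)\<^sup>2) S / bias_sigma p ^ (2 * card S) \<le> \<delta>"
      using assms(6)[OF S] by (simp add: gen_influence_def g)
  qed (use p assms in \<open>auto simp: a_def\<close>)
  \<comment> \<open>The assumption on the values of \<open>f\<close> enters through these two
    identities.\<close>
  have f: "(f x)\<^sup>2 * (f x) = f x" "((f x)\<^sup>2)\<^sup>2 = (f x)\<^sup>2" if "x \<in> cube n" for x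
    using assms(5)[OF that] by auto
  have ff: "expect p n (\<lambda>x. ((f x)\<^sup>2)\<^sup>2) = F"
    unfolding F_def expect_eq_sum by (rule sum.cong) (simp_all only: f)
  define M where "M = expect p n (\<lambda>x. (f x * g x)\<^sup>2)"
  have 1: "W\<^sup>2 \<le> F * M"
  proof -
    \<comment> \<open>The inserted factor \<open>(f x)\<^sup>2\<close> changes nothing, but lets
      Cauchy-Schwarz keep an \<open>f x\<close> beside \<open>g x\<close>, so that \<open>M\<close>
      can be bounded by \<open>F\<close> once more.\<close>
    have "expect p n (\<lambda>x. f x * g x) = expect p n (\<lambda>x. (f x)\<^sup>2 * (f x * g x))"
      unfolding expect_eq_sum by (rule sum.cong) (simp_all add: f mult.assoc[symmetric])
    then show ?thesis
      using expect_Cauchy_Schwarz[of p n "\<lambda>x. (f x)\<^sup>2" "\<lambda>x. f x * g x"] Wf ff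
      by (simp add: M_def)
  qed
  have 2: "M\<^sup>2 \<le> F * expect p n (\<lambda>x. g x ^ 4)"
    using expect_Cauchy_Schwarz[of p n "\<lambda>x. (f x)\<^sup>2" "\<lambda>x. (g x)\<^sup>2"] ff
    by (simp add: M_def power_mult_distrib power_mult[symmetric])
  have "(W\<^sup>2)\<^sup>2 \<le> (F * M)\<^sup>2"
    by (rule power_mono[OF 1]) simp
  also have "\<dots> \<le> F\<^sup>2 * (F * expect p n (\<lambda>x. g x ^ 4))"
    unfolding power_mult_distrib by (rule mult_left_mono[OF 2]) simp
  also have "\<dots> \<le> F\<^sup>2 * (F * (32 ^ r * \<delta> * W))"
    by (intro mult_left_mono g4 F0) simp
  finally have W4: "W ^ 3 * W \<le> F ^ 3 * (32 ^ r * \<delta>) * W"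
    by (simp add: eval_nat_numeral mult_ac)
  have "W \<le> 5 ^ r * \<delta> powr (1 / 3) * F"
  \<comment> \<open>A factor \<open>W\<close> has to be cancelled from \<open>W4\<close>.\<close>
  proof (cases "W = 0")
    case True
    then show ?thesis using F0 by simp
  next
    case False
    with W4 W0 have "W ^ 3 \<le> F ^ 3 * (32 ^ r * \<delta>)" by simp
    \<comment> \<open>Raising 32 to \<open>125 = 5 ^ 3\<close> turns the right-hand side into a cube
      with base \<open>5 ^ r\<close>.\<close>
    also have "\<dots> \<le> F ^ 3 * (125 ^ r * \<delta>)"
      using F0 assms(4) by (intro mult_left_mono mult_right_mono power_mono) auto
    also have "\<dots> = (5 ^ r * \<delta> powr (1 / 3) * F) ^ 3"
    proof -
      have "(\<delta> powr (1 / 3)) ^ 3 = \<delta>"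
        using assms(4) by (simp add: powr_power)
      moreover have "((5::real) ^ r) ^ 3 = 125 ^ r"
        using power_mult[of "5::real" 3 r] power_mult[of "5::real" r 3] by (simp add: mult.commute)
      ultimately show ?thesis by (simp add: power_mult_distrib)
    qed
    \<comment> \<open>Cube roots are taken: the rule compares powers with exponent
      \<open>Suc n\<close>, hence \<open>n = 2\<close>.\<close>
    finally show ?thesis
      by (rule power_le_imp_le_base[where n = 2, simplified]) (use F0 in auto)
  qed
  then show ?thesis unfolding g Wg F_def .
qed

end
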